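(* Let $*:\hat S\to\widehat{{}^*S}$ be an enlargement, let $\mathcal A$ and $\mathcal B$ be $\hat S$-small additive categories, and let $F:\mathcal A\to\mathcal B$ be a functor. (i) If $F$ is additive, then ${}^*F:{}^*\mathcal A\to{}^*\mathcal B$ is also additive. (ii) If $\mathcal A$ and $\mathcal B$ are abelian and if $F$ is left exact (resp. right exact, resp. exact), then ${}^*F$ is also left exact (resp. right exact, resp. exact).
   Context: Superstructures: a base set $S$ is an infinite set whose elements are not sets; $S_0=S$, $S_n=S_{n-1}\cup\mathcal P(S_{n-1})$, and $\hat S=\bigcup_{n\ge 0}S_n$. Formulas in $\hat S$ are built from $=$, $\in$, constants in $\hat S$, variables, ordered pairs and function application by $\neg$, $\wedge$ and bounded quantifiers $\forall x\in t$; statements are formulas without free variables. For $\varphi$ a formula in $\hat S$, ${}^*\varphi$ is obtained by replacing each constant $\tau$ by ${}^*\tau$. Enlargement: a map $*:\hat S\to\hat W$ between superstructures with (1) ${}^*S=W$; (2) ${}^*s=s$ for $s\in S$; (3) (transfer) a statement $\varphi$ in $\hat S$ is true iff ${}^*\varphi$ is true; (4) (saturation) with $\mathcal I=\bigcup_{A\in\hat S\setminus S}{}^*A$ (the internal elements), every nonempty family $\{U_i\}_{i\in I}$ of nonempty sets $U_i\in\mathcal I$ with $|I|\le|\hat S|$ and the finite intersection property has nonempty intersection. $\hat S$-small category: a category $\mathcal A=\langle M,s,t,c\rangle$ given by its set of morphisms $M\in\hat S\setminus S$, the maps $s,t:M\to M$ sending a morphism to the identity of its source resp. target, and the composition relation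 $c$; objects are identified with their identity morphisms. An $\hat S$-small additive (abelian) category is such a category that is additive (abelian) in the usual sense, together with the relation $P\subseteq M^3$ recording addition of morphisms; its enlargement ${}^*\mathcal A=\langle{}^*M,{}^*s,{}^*t,{}^*c\rangle$ with ${}^*P$ is again additive (abelian). A functor $F$ (a map on morphism sets) has an enlargement ${}^*F$, a functor between the enlarged categories. *)

theory Defs
  imports Main "HOL-Library.Equipollence" "HOL-Algebra.Group"
begin

section \<open>The ambient set theory\<close>

text \<open>
  A type of this class is a universe of sets with atoms in which superstructures can be formed:
  \<open>elts x\<close> is the collection of members of \<open>x\<close>, and an object \<open>x\<close> with \<open>\<not> is_set x\<close> is an atom.
  Separation is full, i.e. every subcollection of a set is a set; hence \<open>power_set\<close> yields the true
  power set. Neither infinity nor replacement is required, so that the superstructure over any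
  infinite set of atoms is itself a model of these axioms.
\<close>

class set_universe =
  fixes is_set :: "'a \<Rightarrow> bool" and elts :: "'a \<Rightarrow> 'a set"
  assumes elts_atom: "\<not> is_set x \<Longrightarrow> elts x = {}"
    and extensionality: "is_set x \<Longrightarrow> is_set y \<Longrightarrow> elts x = elts y \<Longrightarrow> x = y"
    and separation: "is_set x \<Longrightarrow> X \<subseteq> elts x \<Longrightarrow> \<exists>y. is_set y \<and> elts y = X"
    and pairing: "\<exists>y. is_set y \<and> elts y = {a, b}"
    and binary_union: "is_set x \<Longrightarrow> is_set y \<Longrightarrow> \<exists>z. is_set z \<and> elts z = elts x \<union> elts y"
    and power_set: "is_set x \<Longrightarrow> \<exists>y. is_set y \<and> elts y = {z. is_set z \<and> elts z \<subseteq> elts x}"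

definition set_of :: "'u::set_universe set \<Rightarrow> 'u" where
  "set_of X = (THE x. is_set x \<and> elts x = X)"

lemma set_of:
  fixes x :: "'u::set_universe"
  assumes "is_set x" "elts x = X"
  shows "set_of X = x"
  unfolding set_of_def using assms extensionality by (intro the_equality) auto

lemma elts_set_of_pair [simp]:
  fixes a b :: "'u::set_universe"
  shows "is_set (set_of {a, b})" "elts (set_of {a, b}) = {a, b}"
  proof -
  obtain y where "is_set y" "elts y = {a, b}" using pairing by blast
  then show "is_set (set_of {a, b})" "elts (set_of {a, b}) = {a, b}"
    by (simp_all add: set_of)
qed

lemma elts_set_of_singleton [simp]:
  fixes a :: "'u::set_universe"
  shows "is_set (set_of {a})" "elts (set_of {a}) = {a}"
  using elts_set_of_pair[of a a] by simp_all

lemma elts_set_of_empty [simp]: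
  shows "is_set (set_of {} :: 'u::set_universe)" "elts (set_of {} :: 'u) = {}"
proof -
  obtain y :: 'u where "is_set y" "elts y = {}"
    using separation[OF elts_set_of_singleton(1), of "{}"] by blast
  then show "is_set (set_of {} :: 'u)" "elts (set_of {} :: 'u) = {}"
    by (simp_all add: set_of)
qed

definition kpair :: "'u::set_universe \<Rightarrow> 'u \<Rightarrow> 'u" where
  "kpair a b = set_of {set_of {a}, set_of {a, b}}"

lemma kpair_inject [simp]: "kpair a b = kpair a' b' \<longleftrightarrow> a = a' \<and> b = b'"
proof
  assume "kpair a b = kpair a' b'"
  then have "elts (kpair a b) = elts (kpair a' b')" by (rule arg_cong)
  then have "{set_of {a}, set_of {a, b}} = {set_of {a'}, set_of {a', b'}}"
    by (simp add: kpair_def)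
  then have "elts ` {set_of {a}, set_of {a, b}} = elts ` {set_of {a'}, set_of {a', b'}}"
    by (rule arg_cong)
  then have "{{a}, {a, b}} = {{a'}, {a', b'}}" by simp
  then show "a = a' \<and> b = b'" by (auto simp: doubleton_eq_iff)
qed simp

definition ktriple :: "'u::set_universe \<Rightarrow> 'u \<Rightarrow> 'u \<Rightarrow> 'u" where
  "ktriple a b c = kpair a (kpair b c)"

text \<open>
  Function application inside the universe, made total in the customary way: its value is the
  empty set unless there is exactly one \<open>y\<close> such that the pair of \<open>x\<close> and \<open>y\<close> belongs to \<open>f\<close>.
\<close>

definition sapp :: "'u::set_universe \<Rightarrow> 'u \<Rightarrow> 'u" where
  "sapp f x = (if \<exists>!y. kpair x y \<in> elts f then THE y. kpair x y \<in> elts f else set_of {})"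

definition is_function :: "'u::set_universe \<Rightarrow> 'u \<Rightarrow> 'u \<Rightarrow> bool" where
  "is_function f X Y \<longleftrightarrow> is_set f
    \<and> (\<forall>p\<in>elts f. \<exists>x\<in>elts X. \<exists>y\<in>elts Y. p = kpair x y)
    \<and> (\<forall>x\<in>elts X. \<exists>!y. y \<in> elts Y \<and> kpair x y \<in> elts f)"

definition is_ternary_relation :: "'u::set_universe \<Rightarrow> 'u \<Rightarrow> bool" where
  "is_ternary_relation r X \<longleftrightarrow> is_set r
    \<and> (\<forall>p\<in>elts r. \<exists>x\<in>elts X. \<exists>y\<in>elts X. \<exists>z\<in>elts X. p = ktriple x y z)"


section \<open>Superstructures and enlargements\<close>

definition base_set :: "'u::set_universe \<Rightarrow> bool" where
  "base_set S \<longleftrightarrow> is_set S \<and> infinite (elts S) \<and> (\<forall>s\<in>elts S. \<not> is_set s)"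

primrec level :: "'u::set_universe \<Rightarrow> nat \<Rightarrow> 'u set" where
  "level S 0 = elts S"
| "level S (Suc n) = level S n \<union> {x. is_set x \<and> elts x \<subseteq> level S n}"

definition superstructure :: "'u::set_universe \<Rightarrow> 'u set" where
  "superstructure S = (\<Union>n. level S n)"

datatype 'c trm =
    Const 'c
  | Var nat
  | Pair "'c trm" "'c trm"
  | App "'c trm" "'c trm"

datatype 'c fm =
    Eq "'c trm" "'c trm"
  | Mem "'c trm" "'c trm"
  | Neg "'c fm"
  | Conj "'c fm" "'c fm"
  | Ball nat "'c trm" "'c fm"

primrec trm_vars :: "'c trm \<Rightarrow> nat set" where
  "trm_vars (Const c) = {}"
| "trm_vars (Var i) = {i}"
| "trm_vars (Pair p q) = trm_vars p \<union> trm_vars q"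
| "trm_vars (App p q) = trm_vars p \<union> trm_vars q"

text \<open>In \<open>Ball i p \<phi>\<close> the bounding term \<open>p\<close> lies outside the scope of the bound variable.\<close>

primrec free_vars :: "'c fm \<Rightarrow> nat set" where
  "free_vars (Eq p q) = trm_vars p \<union> trm_vars q"
| "free_vars (Mem p q) = trm_vars p \<union> trm_vars q"
| "free_vars (Neg \<phi>) = free_vars \<phi>"
| "free_vars (Conj \<phi> \<psi>) = free_vars \<phi> \<union> free_vars \<psi>"
| "free_vars (Ball i p \<phi>) = trm_vars p \<union> (free_vars \<phi> - {i})"

primrec trm_val :: "(nat \<Rightarrow> 'u) \<Rightarrow> 'u::set_universe trm \<Rightarrow> 'u" where
  "trm_val e (Const c) = c"
| "trm_val e (Var i) = e i"
| "trm_val e (Pair p q) = kpair (trm_val e p) (trm_val e q)"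
| "trm_val e (App p q) = sapp (trm_val e p) (trm_val e q)"

primrec holds :: "(nat \<Rightarrow> 'u) \<Rightarrow> 'u::set_universe fm \<Rightarrow> bool" where
  "holds e (Eq p q) \<longleftrightarrow> trm_val e p = trm_val e q"
| "holds e (Mem p q) \<longleftrightarrow> trm_val e p \<in> elts (trm_val e q)"
| "holds e (Neg \<phi>) \<longleftrightarrow> \<not> holds e \<phi>"
| "holds e (Conj \<phi> \<psi>) \<longleftrightarrow> holds e \<phi> \<and> holds e \<psi>"
| "holds e (Ball i p \<phi>) \<longleftrightarrow> (\<forall>x\<in>elts (trm_val e p). holds (e(i := x)) \<phi>)"

text \<open>A statement in the superstructure over \<open>S\<close>; its constants are the elements of \<open>set_fm \<phi>\<close>.\<close>

definition is_statement :: "'u::set_universe \<Rightarrow> 'u fm \<Rightarrow> bool" where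
  "is_statement S \<phi> \<longleftrightarrow> free_vars \<phi> = {} \<and> set_fm \<phi> \<subseteq> superstructure S"

definition is_true :: "'u::set_universe fm \<Rightarrow> bool" where
  "is_true \<phi> \<longleftrightarrow> (\<forall>e. holds e \<phi>)"

definition internal :: "'u::set_universe \<Rightarrow> ('u \<Rightarrow> 'u) \<Rightarrow> 'u set" where
  "internal S star = (\<Union>A \<in> superstructure S - elts S. elts (star A))"

text \<open>
  Only the values of \<open>star\<close> on the superstructure over \<open>S\<close> matter. The cardinality bound on the
  index set \<open>I\<close> makes it harmless that \<open>I\<close> is taken from the same type.
\<close>

definition enlargement :: "'u::set_universe \<Rightarrow> 'u \<Rightarrow> ('u \<Rightarrow> 'u) \<Rightarrow> bool" where
  "enlargement S W star \<longleftrightarrow>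
     base_set S \<and> base_set W
   \<and> (\<forall>x\<in>superstructure S. star x \<in> superstructure W)
   \<and> star S = W
   \<and> (\<forall>s\<in>elts S. star s = s)
   \<and> (\<forall>\<phi>. is_statement S \<phi> \<longrightarrow> (is_true \<phi> \<longleftrightarrow> is_true (map_fm star \<phi>)))
   \<and> (\<forall>(I :: 'u set) (U :: 'u \<Rightarrow> 'u).
        I \<noteq> {} \<and> I \<lesssim> superstructure S
        \<and> (\<forall>i\<in>I. U i \<in> internal S star \<and> is_set (U i) \<and> elts (U i) \<noteq> {})
        \<and> (\<forall>J. finite J \<and> J \<noteq> {} \<and> J \<subseteq> I \<longrightarrow> (\<Inter>i\<in>J. elts (U i)) \<noteq> {})
        \<longrightarrow> (\<Inter>i\<in>I. elts (U i)) \<noteq> {})"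


section \<open>Categories given by their morphisms\<close>

text \<open>
  The fields are elements of the universe: the set of morphisms, the two maps sending a morphism
  to the identity of its source and of its target, and the composition relation.
\<close>

record 'u cat =
  mor :: 'u
  src :: 'u
  tgt :: 'u
  cmp :: 'u

record 'u add_cat = "'u cat" +
  add :: 'u

abbreviation Mor :: "('u::set_universe, 'z) cat_scheme \<Rightarrow> 'u set" where
  "Mor C \<equiv> elts (mor C)"

abbreviation Src :: "('u::set_universe, 'z) cat_scheme \<Rightarrow> 'u \<Rightarrow> 'u" where
  "Src C \<equiv> sapp (src C)"

abbreviation Tgt :: "('u::set_universe, 'z) cat_scheme \<Rightarrow> 'u \<Rightarrow> 'u" where
  "Tgt C \<equiv> sapp (tgt C)"

text \<open>\<open>Comp C g f h\<close> means \<open>g \<circ> f = h\<close> (first \<open>f\<close>, then \<open>g\<close>), and \<open>Sum C f g h\<close> means \<open>f + g = h\<close>.\<close>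

definition Comp :: "('u::set_universe, 'z) cat_scheme \<Rightarrow> 'u \<Rightarrow> 'u \<Rightarrow> 'u \<Rightarrow> bool" where
  "Comp C g f h \<longleftrightarrow> ktriple g f h \<in> elts (cmp C)"

definition Sum :: "('u::set_universe, 'z) add_cat_scheme \<Rightarrow> 'u \<Rightarrow> 'u \<Rightarrow> 'u \<Rightarrow> bool" where
  "Sum C f g h \<longleftrightarrow> ktriple f g h \<in> elts (add C)"

definition is_category :: "('u::set_universe, 'z) cat_scheme \<Rightarrow> bool" where
  "is_category C \<longleftrightarrow>
     is_set (mor C)
   \<and> is_function (src C) (mor C) (mor C)
   \<and> is_function (tgt C) (mor C) (mor C)
   \<and> is_ternary_relation (cmp C) (mor C)
   \<and> (\<forall>f\<in>Mor C. Src C (Src C f) = Src C f \<and> Tgt C (Src C f) = Src C f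
               \<and> Src C (Tgt C f) = Tgt C f \<and> Tgt C (Tgt C f) = Tgt C f)
   \<and> (\<forall>g f h. Comp C g f h \<longrightarrow> Src C g = Tgt C f \<and> Src C h = Src C f \<and> Tgt C h = Tgt C g)
   \<and> (\<forall>g\<in>Mor C. \<forall>f\<in>Mor C. Src C g = Tgt C f \<longrightarrow> (\<exists>!h. Comp C g f h))
   \<and> (\<forall>f\<in>Mor C. Comp C f (Src C f) f \<and> Comp C (Tgt C f) f f)
   \<and> (\<forall>f g h gf hg k. Comp C g f gf \<and> Comp C h g hg \<longrightarrow> (Comp C h gf k \<longleftrightarrow> Comp C hg f k))"

definition Ob :: "('u::set_universe, 'z) cat_scheme \<Rightarrow> 'u set" where
  "Ob C = {a \<in> Mor C. Src C a = a}"

definition Hom :: "('u::set_universe, 'z) cat_scheme \<Rightarrow> 'u \<Rightarrow> 'u \<Rightarrow> 'u set" where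
  "Hom C a b = {f \<in> Mor C. Src C f = a \<and> Tgt C f = b}"

definition is_mono :: "('u::set_universe, 'z) cat_scheme \<Rightarrow> 'u \<Rightarrow> bool" where
  "is_mono C m \<longleftrightarrow> m \<in> Mor C
    \<and> (\<forall>x\<in>Mor C. \<forall>y\<in>Mor C. \<forall>w\<in>Mor C. Comp C m x w \<and> Comp C m y w \<longrightarrow> x = y)"

definition is_epi :: "('u::set_universe, 'z) cat_scheme \<Rightarrow> 'u \<Rightarrow> bool" where
  "is_epi C e \<longleftrightarrow> e \<in> Mor C
    \<and> (\<forall>x\<in>Mor C. \<forall>y\<in>Mor C. \<forall>w\<in>Mor C. Comp C x e w \<and> Comp C y e w \<longrightarrow> x = y)"

definition is_zero_object :: "('u::set_universe, 'z) cat_scheme \<Rightarrow> 'u \<Rightarrow> bool" where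
  "is_zero_object C z \<longleftrightarrow> z \<in> Ob C
    \<and> (\<forall>a\<in>Ob C. (\<exists>!f. f \<in> Hom C z a) \<and> (\<exists>!f. f \<in> Hom C a z))"

definition is_product :: "('u::set_universe, 'z) cat_scheme \<Rightarrow> 'u \<Rightarrow> 'u \<Rightarrow> 'u \<Rightarrow> 'u \<Rightarrow> 'u \<Rightarrow> bool" where
  "is_product C a b p \<pi>\<^sub>1 \<pi>\<^sub>2 \<longleftrightarrow> \<pi>\<^sub>1 \<in> Hom C p a \<and> \<pi>\<^sub>2 \<in> Hom C p b
    \<and> (\<forall>x\<in>Ob C. \<forall>f\<in>Hom C x a. \<forall>g\<in>Hom C x b.
         \<exists>!h. h \<in> Hom C x p \<and> Comp C \<pi>\<^sub>1 h f \<and> Comp C \<pi>\<^sub>2 h g)"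


section \<open>Additive and abelian categories\<close>

definition hom_group :: "('u::set_universe, 'z) add_cat_scheme \<Rightarrow> 'u \<Rightarrow> 'u \<Rightarrow> 'u \<Rightarrow> 'u monoid" where
  "hom_group C a b e = \<lparr>carrier = Hom C a b, monoid.mult = (\<lambda>f g. THE h. Sum C f g h), one = e\<rparr>"

definition additive_category :: "('u::set_universe, 'z) add_cat_scheme \<Rightarrow> bool" where
  "additive_category C \<longleftrightarrow>
     is_category C
   \<and> is_ternary_relation (add C) (mor C)
   \<and> (\<forall>f g h. Sum C f g h \<longrightarrow> Src C f = Src C g \<and> Src C g = Src C h
                           \<and> Tgt C f = Tgt C g \<and> Tgt C g = Tgt C h)
   \<and> (\<forall>a\<in>Ob C. \<forall>b\<in>Ob C. (\<forall>f\<in>Hom C a b. \<forall>g\<in>Hom C a b. \<exists>!h. Sum C f g h)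
                       \<and> (\<exists>e. comm_group (hom_group C a b e)))
   \<and> (\<forall>f f' f'' g h h' h''. Sum C f f' f'' \<and> Comp C g f h \<and> Comp C g f' h' \<and> Comp C g f'' h''
         \<longrightarrow> Sum C h h' h'')
   \<and> (\<forall>f g g' g'' h h' h''. Sum C g g' g'' \<and> Comp C g f h \<and> Comp C g' f h' \<and> Comp C g'' f h''
         \<longrightarrow> Sum C h h' h'')
   \<and> (\<exists>z. is_zero_object C z)
   \<and> (\<forall>a\<in>Ob C. \<forall>b\<in>Ob C. \<exists>p\<in>Ob C. \<exists>\<pi>\<^sub>1 \<pi>\<^sub>2. is_product C a b p \<pi>\<^sub>1 \<pi>\<^sub>2)"

text \<open>The neutral element of the group of morphisms with the given source and target.\<close>

definition is_zero_mor :: "('u::set_universe, 'z) add_cat_scheme \<Rightarrow> 'u \<Rightarrow> bool" where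
  "is_zero_mor C f \<longleftrightarrow> f \<in> Mor C \<and> (\<forall>g\<in>Hom C (Src C f) (Tgt C f). Sum C f g g)"

definition comp_zero :: "('u::set_universe, 'z) add_cat_scheme \<Rightarrow> 'u \<Rightarrow> 'u \<Rightarrow> bool" where
  "comp_zero C g f \<longleftrightarrow> (\<exists>n\<in>Mor C. is_zero_mor C n \<and> Comp C g f n)"

definition is_kernel :: "('u::set_universe, 'z) add_cat_scheme \<Rightarrow> 'u \<Rightarrow> 'u \<Rightarrow> bool" where
  "is_kernel C k f \<longleftrightarrow> k \<in> Mor C \<and> f \<in> Mor C \<and> comp_zero C f k
    \<and> (\<forall>x\<in>Mor C. comp_zero C f x \<longrightarrow> (\<exists>!y. y \<in> Mor C \<and> Comp C k y x))"

definition is_cokernel :: "('u::set_universe, 'z) add_cat_scheme \<Rightarrow> 'u \<Rightarrow> 'u \<Rightarrow> bool" where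
  "is_cokernel C q f \<longleftrightarrow> q \<in> Mor C \<and> f \<in> Mor C \<and> comp_zero C q f
    \<and> (\<forall>x\<in>Mor C. comp_zero C x f \<longrightarrow> (\<exists>!y. y \<in> Mor C \<and> Comp C y q x))"

definition abelian_category :: "('u::set_universe, 'z) add_cat_scheme \<Rightarrow> bool" where
  "abelian_category C \<longleftrightarrow> additive_category C
   \<and> (\<forall>f\<in>Mor C. (\<exists>k. is_kernel C k f) \<and> (\<exists>q. is_cokernel C q f))
   \<and> (\<forall>m. is_mono C m \<longrightarrow> (\<exists>f. is_kernel C m f))
   \<and> (\<forall>e. is_epi C e \<longrightarrow> (\<exists>f. is_cokernel C e f))"

text \<open>
  Exactness of two consecutive morphisms \<open>f\<close>, \<open>g\<close>: the image of \<open>f\<close>, i.e. the kernel of its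
  cokernel, is the kernel of \<open>g\<close>.
\<close>

definition exact_pair :: "('u::set_universe, 'z) add_cat_scheme \<Rightarrow> 'u \<Rightarrow> 'u \<Rightarrow> bool" where
  "exact_pair C f g \<longleftrightarrow>
     (\<exists>q\<in>Mor C. \<exists>i\<in>Mor C. is_cokernel C q f \<and> is_kernel C i q \<and> is_kernel C i g)"

text \<open>
  Below, \<open>u\<close> is the morphism from a zero object to the source of \<open>f\<close>, and \<open>v\<close> the morphism from the
  target of \<open>g\<close> to a zero object: exactness of \<open>0 \<rightarrow> A \<rightarrow> B\<close> at \<open>A\<close> and of \<open>B \<rightarrow> C \<rightarrow> 0\<close> at \<open>C\<close>.
\<close>

definition exact_zero_left :: "('u::set_universe, 'z) add_cat_scheme \<Rightarrow> 'u \<Rightarrow> bool" where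
  "exact_zero_left C f \<longleftrightarrow> (\<exists>u\<in>Mor C. is_zero_object C (Src C u) \<and> exact_pair C u f)"

definition exact_zero_right :: "('u::set_universe, 'z) add_cat_scheme \<Rightarrow> 'u \<Rightarrow> bool" where
  "exact_zero_right C g \<longleftrightarrow> (\<exists>v\<in>Mor C. is_zero_object C (Tgt C v) \<and> exact_pair C g v)"

definition short_exact :: "('u::set_universe, 'z) add_cat_scheme \<Rightarrow> 'u \<Rightarrow> 'u \<Rightarrow> bool" where
  "short_exact C f g \<longleftrightarrow> exact_zero_left C f \<and> exact_pair C f g \<and> exact_zero_right C g"


section \<open>Functors\<close>

text \<open>Preservation of identities is part of compatibility with source and target.\<close>

definition is_functor ::
    "('u::set_universe, 'y) cat_scheme \<Rightarrow> ('u, 'z) cat_scheme \<Rightarrow> 'u \<Rightarrow> bool" where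
  "is_functor A B F \<longleftrightarrow>
     is_function F (mor A) (mor B)
   \<and> (\<forall>f\<in>Mor A. sapp F (Src A f) = Src B (sapp F f) \<and> sapp F (Tgt A f) = Tgt B (sapp F f))
   \<and> (\<forall>g\<in>Mor A. \<forall>f\<in>Mor A. \<forall>h\<in>Mor A.
        Comp A g f h \<longrightarrow> Comp B (sapp F g) (sapp F f) (sapp F h))"

definition additive_functor ::
    "('u::set_universe, 'y) add_cat_scheme \<Rightarrow> ('u, 'z) add_cat_scheme \<Rightarrow> 'u \<Rightarrow> bool" where
  "additive_functor A B F \<longleftrightarrow> is_functor A B F
   \<and> (\<forall>f\<in>Mor A. \<forall>g\<in>Mor A. \<forall>h\<in>Mor A.
        Sum A f g h \<longrightarrow> Sum B (sapp F f) (sapp F g) (sapp F h))"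

definition left_exact ::
    "('u::set_universe, 'y) add_cat_scheme \<Rightarrow> ('u, 'z) add_cat_scheme \<Rightarrow> 'u \<Rightarrow> bool" where
  "left_exact A B F \<longleftrightarrow> additive_functor A B F
   \<and> (\<forall>f\<in>Mor A. \<forall>g\<in>Mor A. short_exact A f g
        \<longrightarrow> exact_zero_left B (sapp F f) \<and> exact_pair B (sapp F f) (sapp F g))"

definition right_exact ::
    "('u::set_universe, 'y) add_cat_scheme \<Rightarrow> ('u, 'z) add_cat_scheme \<Rightarrow> 'u \<Rightarrow> bool" where
  "right_exact A B F \<longleftrightarrow> additive_functor A B F
   \<and> (\<forall>f\<in>Mor A. \<forall>g\<in>Mor A. short_exact A f g
        \<longrightarrow> exact_pair B (sapp F f) (sapp F g) \<and> exact_zero_right B (sapp F g))"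

definition exact_functor ::
    "('u::set_universe, 'y) add_cat_scheme \<Rightarrow> ('u, 'z) add_cat_scheme \<Rightarrow> 'u \<Rightarrow> bool" where
  "exact_functor A B F \<longleftrightarrow> additive_functor A B F
   \<and> (\<forall>f\<in>Mor A. \<forall>g\<in>Mor A. short_exact A f g \<longrightarrow> short_exact B (sapp F f) (sapp F g))"


section \<open>Small categories in a superstructure\<close>

text \<open>
  Requiring only the set of morphisms to lie in the superstructure suffices: a function between,
  or a relation on, sets in the superstructure lies in the superstructure as well.
\<close>

definition small_in :: "'u::set_universe \<Rightarrow> ('u, 'z) cat_scheme \<Rightarrow> bool" where
  "small_in S C \<longleftrightarrow> mor C \<in> superstructure S - elts S"

definition enlarge_cat :: "('u::set_universe \<Rightarrow> 'u) \<Rightarrow> 'u add_cat \<Rightarrow> 'u add_cat" where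
  "enlarge_cat star C =
     \<lparr>mor = star (mor C), src = star (src C), tgt = star (tgt C), cmp = star (cmp C),
      add = star (add C)\<rparr>"

end

theory Submission
  imports Defs
begin

text \<open>
  Functoriality, additivity and the three kinds of exactness are first-order properties of the
  morphism sets, the structure maps and relations of \<open>A\<close> and \<open>B\<close>, and \<open>F\<close>, and all their
  quantifiers are bounded by these sets. Hence each of them is expressed by a statement with these
  data as constants, and transfer carries it to the enlargements.

  Three points need an argument. The data other than the morphism sets lie in the superstructure,
  because they are sets of pairs or triples of elements of a fixed level
  (\<open>function_in_superstructure\<close>, \<open>ternary_relation_in_superstructure\<close>). Being a set is not among
  the atomic formulas, but an element \<open>c\<close> of a superstructure is a set precisely if it is not in
  the base set, so that for a constant it is expressed by \<open>\<not> c \<in> S\<close>, which transfer turns into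
  \<open>\<not> star c \<in> star S\<close> (\<open>is_set_iff_notin_base\<close>). Finally, the formulas are never written out:
  \<open>definable\<close> below is a predicate on families of relations, one relation on the original structure
  and one on the enlarged structure, saying that one formula expresses both; it is closed under the
  logical operations and bounded quantification, and so every notion is shown to be definable by
  following its definition. The transfer principle then becomes \<open>transfer_definable\<close>.
\<close>

section \<open>Membership in superstructures\<close>

lemma level_mono: "m \<le> n \<Longrightarrow> level S m \<subseteq> level S n"
  by (induction n rule: dec_induct) auto

lemma elts_subset_level:
  assumes "x \<in> level S n" "x \<notin> elts S"
  shows "elts x \<subseteq> level S n"
  using assms
proof (induction n)
  case 0
  then show ?case by simp
next
  case (Suc n)
  then show ?case by auto
qed

lemma kpair_in_level:
  assumes "a \<in> level S n" "b \<in> level S n"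
  shows "kpair a b \<in> level S (Suc (Suc n))"
  using assms by (simp add: kpair_def)

lemma is_set_in_superstructure:
  assumes "is_set x" "elts x \<subseteq> level S n"
  shows "x \<in> superstructure S"
proof -
  have "x \<in> level S (Suc n)" using assms by simp
  then show ?thesis unfolding superstructure_def by blast
qed

lemma superstructure_elts_subset_level:
  assumes "x \<in> superstructure S - elts S"
  obtains n where "elts x \<subseteq> level S n"
  using assms elts_subset_level unfolding superstructure_def by blast

lemma is_set_iff_notin_base:
  assumes "base_set S" "x \<in> superstructure S"
  shows "is_set x \<longleftrightarrow> x \<notin> elts S"
proof
  assume "is_set x"
  then show "x \<notin> elts S" using assms(1) unfolding base_set_def by blast
next
  assume x: "x \<notin> elts S"
  have "x \<in> level S n \<Longrightarrow> is_set x" for n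
    using x by (induction n) auto
  then show "is_set x" using assms(2) unfolding superstructure_def by blast
qed

text \<open>
  A Kuratowski pair lies two levels above its entries, so a set of pairs from a fixed level is again
  contained in a level.
\<close>

lemma function_in_superstructure:
  assumes "is_function f X Y"
    and "X \<in> superstructure S - elts S" "Y \<in> superstructure S - elts S"
  shows "f \<in> superstructure S"
proof -
  obtain m where m: "elts X \<subseteq> level S m"
    using superstructure_elts_subset_level assms(2) by blast
  obtain n where n: "elts Y \<subseteq> level S n"
    using superstructure_elts_subset_level assms(3) by blast
  let ?k = "max m n"
  have XY: "elts X \<subseteq> level S ?k" "elts Y \<subseteq> level S ?k"
    using m n level_mono[of m ?k S] level_mono[of n ?k S] by auto
  have "elts f \<subseteq> level S (Suc (Suc ?k))"
  proof
    fix p assume "p \<in> elts f"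
    then obtain x y where "x \<in> elts X" "y \<in> elts Y" "p = kpair x y"
      using assms(1) unfolding is_function_def by meson
    then show "p \<in> level S (Suc (Suc ?k))"
      using XY kpair_in_level[of x S ?k y] by (metis subsetD)
  qed
  moreover have "is_set f" using assms(1) unfolding is_function_def by simp
  ultimately show ?thesis by (rule is_set_in_superstructure[rotated])
qed

lemma ternary_relation_in_superstructure:
  assumes "is_ternary_relation r X" "X \<in> superstructure S - elts S"
  shows "r \<in> superstructure S"
proof -
  obtain n where n: "elts X \<subseteq> level S n"
    using superstructure_elts_subset_level assms(2) by blast
  have "elts r \<subseteq> level S (Suc (Suc (Suc (Suc n))))"
  proof
    fix p assume "p \<in> elts r"
    then obtain x y z where xyz: "x \<in> elts X" "y \<in> elts X" "z \<in> elts X"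
      and p: "p = ktriple x y z"
      using assms(1) unfolding is_ternary_relation_def by meson
    have "kpair y z \<in> level S (Suc (Suc n))"
      using xyz n by (intro kpair_in_level) auto
    moreover have "x \<in> level S (Suc (Suc n))"
      using xyz n level_mono[of n "Suc (Suc n)" S] by auto
    ultimately show "p \<in> level S (Suc (Suc (Suc (Suc n))))"
      unfolding p ktriple_def by (rule kpair_in_level[rotated])
  qed
  moreover have "is_set r" using assms(1) unfolding is_ternary_relation_def by simp
  ultimately show ?thesis by (rule is_set_in_superstructure[rotated])
qed


section \<open>Relations expressed by bounded formulas\<close>

locale enlarged_superstructure =
  fixes S :: "'u::set_universe" and star :: "'u \<Rightarrow> 'u"
  assumes enl: "enlargement S (star S) star"
begin

text \<open>
  The values of the variables \<open>0, \<dots>, n - 1\<close> under \<open>\<eta>\<close> are listed by \<open>e\<close>, with the last variable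
  first: entering a quantifier gives a value to the variable \<open>n\<close> and puts that value at the head
  of the list.
\<close>

definition assigns :: "nat \<Rightarrow> 'u list \<Rightarrow> (nat \<Rightarrow> 'u) \<Rightarrow> bool" where
  "assigns n e \<eta> \<longleftrightarrow> length e = n \<and> (\<forall>i<n. \<eta> i = rev e ! i)"

lemma assigns_0: "assigns 0 [] \<eta>"
  by (simp add: assigns_def)

lemma assigns_Cons: "assigns n e \<eta> \<Longrightarrow> assigns (Suc n) (x # e) (\<eta>(n := x))"
  by (auto simp: assigns_def nth_append less_Suc_eq)

lemma assigns_tl: "assigns (Suc n) e \<eta> \<Longrightarrow> assigns n (tl e) \<eta>"
  by (cases e) (auto simp: assigns_def nth_append)

text \<open>
  A family of relations \<open>P\<close> takes an interpretation \<open>\<sigma>\<close> of the constants, which is \<open>id\<close> for the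
  original structure and \<open>star\<close> for the enlarged one, and a list of \<open>n\<close> arguments. It is definable
  if one formula, not depending on \<open>\<sigma>\<close>, expresses \<open>P \<sigma>\<close> for both choices of \<open>\<sigma>\<close>.
\<close>

definition definable :: "nat \<Rightarrow> (('u \<Rightarrow> 'u) \<Rightarrow> 'u list \<Rightarrow> bool) \<Rightarrow> bool" where
  "definable n P \<longleftrightarrow> (\<exists>\<phi>. set_fm \<phi> \<subseteq> superstructure S \<and> free_vars \<phi> \<subseteq> {..<n}
     \<and> (\<forall>\<sigma>\<in>{id, star}. \<forall>e \<eta>. assigns n e \<eta>
           \<longrightarrow> (holds \<eta> (map_fm \<sigma> \<phi>) \<longleftrightarrow> P \<sigma> e)))"

text \<open>The same for element-valued families, which are given by a term.\<close>

definition definable_term :: "nat \<Rightarrow> (('u \<Rightarrow> 'u) \<Rightarrow> 'u list \<Rightarrow> 'u) \<Rightarrow> bool" where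
  "definable_term n t \<longleftrightarrow> (\<exists>\<tau>. set_trm \<tau> \<subseteq> superstructure S \<and> trm_vars \<tau> \<subseteq> {..<n}
     \<and> (\<forall>\<sigma>\<in>{id, star}. \<forall>e \<eta>. assigns n e \<eta>
           \<longrightarrow> trm_val \<eta> (map_trm \<sigma> \<tau>) = t \<sigma> e))"

lemma transfer_definable:
  assumes "definable 0 (\<lambda>\<sigma> e. P \<sigma>)"
  shows "P id \<longleftrightarrow> P star"
proof -
  obtain \<phi> where \<phi>: "set_fm \<phi> \<subseteq> superstructure S" "free_vars \<phi> \<subseteq> {..<0}"
    and h: "\<forall>\<sigma>\<in>{id, star}. \<forall>e \<eta>. assigns 0 e \<eta>
           \<longrightarrow> (holds \<eta> (map_fm \<sigma> \<phi>) \<longleftrightarrow> P \<sigma>)"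
    using assms unfolding definable_def by blast
  have "is_true \<phi> \<longleftrightarrow> P id"
    using h assigns_0 unfolding is_true_def by (fastforce simp: fm.map_id)
  moreover have "is_true (map_fm star \<phi>) \<longleftrightarrow> P star"
    using h assigns_0 unfolding is_true_def by fastforce
  moreover have "is_statement S \<phi>"
    using \<phi> unfolding is_statement_def by simp
  ultimately show ?thesis
    using enl unfolding enlargement_def by blast
qed

lemma definable_term_const:
  assumes "c \<in> superstructure S"
  shows "definable_term n (\<lambda>\<sigma> e. \<sigma> c)"
  unfolding definable_term_def using assms by (intro exI[of _ "Const c"]) simp

lemma definable_term_hd: "definable_term (Suc n) (\<lambda>\<sigma> e. hd e)"
  unfolding definable_term_def
proof (intro exI[of _ "Var n"] conjI ballI allI impI)
  fix \<sigma> :: "'u \<Rightarrow> 'u" and e :: "'u list" and \<eta>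
  assume "assigns (Suc n) e \<eta>"
  then show "trm_val \<eta> (map_trm \<sigma> (Var n)) = hd e"
    by (cases e) (auto simp: assigns_def nth_append)
qed auto

lemma definable_term_tl:
  assumes "definable_term n t"
  shows "definable_term (Suc n) (\<lambda>\<sigma> e. t \<sigma> (tl e))"
proof -
  obtain \<tau> where \<tau>: "set_trm \<tau> \<subseteq> superstructure S" "trm_vars \<tau> \<subseteq> {..<n}"
    and h: "\<And>\<sigma> e \<eta>. \<sigma> \<in> {id, star} \<Longrightarrow> assigns n e \<eta>
           \<Longrightarrow> trm_val \<eta> (map_trm \<sigma> \<tau>) = t \<sigma> e"
    using assms unfolding definable_term_def by blast
  have "trm_val \<eta> (map_trm \<sigma> \<tau>) = t \<sigma> (tl e)"
    if "\<sigma> \<in> {id, star}" "assigns (Suc n) e \<eta>" for \<sigma> e \<eta>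
    using that by (intro h assigns_tl)
  then show ?thesis
    unfolding definable_term_def using \<tau> by (intro exI[of _ \<tau>]) auto
qed

lemma definable_term_kpair:
  assumes "definable_term n t" "definable_term n u"
  shows "definable_term n (\<lambda>\<sigma> e. kpair (t \<sigma> e) (u \<sigma> e))"
proof -
  obtain \<tau> \<upsilon> where "set_trm \<tau> \<subseteq> superstructure S" "trm_vars \<tau> \<subseteq> {..<n}"
    "set_trm \<upsilon> \<subseteq> superstructure S" "trm_vars \<upsilon> \<subseteq> {..<n}"
    "\<forall>\<sigma>\<in>{id, star}. \<forall>e \<eta>. assigns n e \<eta>
           \<longrightarrow> trm_val \<eta> (map_trm \<sigma> \<tau>) = t \<sigma> e"
    "\<forall>\<sigma>\<in>{id, star}. \<forall>e \<eta>. assigns n e \<eta>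
           \<longrightarrow> trm_val \<eta> (map_trm \<sigma> \<upsilon>) = u \<sigma> e"
    using assms unfolding definable_term_def by blast
  then show ?thesis
    unfolding definable_term_def by (intro exI[of _ "Pair \<tau> \<upsilon>"]) auto
qed

lemma definable_term_sapp:
  assumes "definable_term n t" "definable_term n u"
  shows "definable_term n (\<lambda>\<sigma> e. sapp (t \<sigma> e) (u \<sigma> e))"
proof -
  obtain \<tau> \<upsilon> where "set_trm \<tau> \<subseteq> superstructure S" "trm_vars \<tau> \<subseteq> {..<n}"
    "set_trm \<upsilon> \<subseteq> superstructure S" "trm_vars \<upsilon> \<subseteq> {..<n}"
    "\<forall>\<sigma>\<in>{id, star}. \<forall>e \<eta>. assigns n e \<eta>
           \<longrightarrow> trm_val \<eta> (map_trm \<sigma> \<tau>) = t \<sigma> e"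
    "\<forall>\<sigma>\<in>{id, star}. \<forall>e \<eta>. assigns n e \<eta>
           \<longrightarrow> trm_val \<eta> (map_trm \<sigma> \<upsilon>) = u \<sigma> e"
    using assms unfolding definable_term_def by blast
  then show ?thesis
    unfolding definable_term_def by (intro exI[of _ "App \<tau> \<upsilon>"]) auto
qed

lemma definable_eq:
  assumes "definable_term n t" "definable_term n u"
  shows "definable n (\<lambda>\<sigma> e. t \<sigma> e = u \<sigma> e)"
proof -
  obtain \<tau> \<upsilon> where "set_trm \<tau> \<subseteq> superstructure S" "trm_vars \<tau> \<subseteq> {..<n}"
    "set_trm \<upsilon> \<subseteq> superstructure S" "trm_vars \<upsilon> \<subseteq> {..<n}"
    "\<forall>\<sigma>\<in>{id, star}. \<forall>e \<eta>. assigns n e \<eta>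
           \<longrightarrow> trm_val \<eta> (map_trm \<sigma> \<tau>) = t \<sigma> e"
    "\<forall>\<sigma>\<in>{id, star}. \<forall>e \<eta>. assigns n e \<eta>
           \<longrightarrow> trm_val \<eta> (map_trm \<sigma> \<upsilon>) = u \<sigma> e"
    using assms unfolding definable_term_def by blast
  then show ?thesis
    unfolding definable_def by (intro exI[of _ "Eq \<tau> \<upsilon>"]) auto
qed

lemma definable_mem:
  assumes "definable_term n t" "definable_term n u"
  shows "definable n (\<lambda>\<sigma> e. t \<sigma> e \<in> elts (u \<sigma> e))"
proof -
  obtain \<tau> \<upsilon> where "set_trm \<tau> \<subseteq> superstructure S" "trm_vars \<tau> \<subseteq> {..<n}"
    "set_trm \<upsilon> \<subseteq> superstructure S" "trm_vars \<upsilon> \<subseteq> {..<n}"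
    "\<forall>\<sigma>\<in>{id, star}. \<forall>e \<eta>. assigns n e \<eta>
           \<longrightarrow> trm_val \<eta> (map_trm \<sigma> \<tau>) = t \<sigma> e"
    "\<forall>\<sigma>\<in>{id, star}. \<forall>e \<eta>. assigns n e \<eta>
           \<longrightarrow> trm_val \<eta> (map_trm \<sigma> \<upsilon>) = u \<sigma> e"
    using assms unfolding definable_term_def by blast
  then show ?thesis
    unfolding definable_def by (intro exI[of _ "Mem \<tau> \<upsilon>"]) auto
qed

lemma definable_not:
  assumes "definable n P"
  shows "definable n (\<lambda>\<sigma> e. \<not> P \<sigma> e)"
proof -
  obtain \<phi> where "set_fm \<phi> \<subseteq> superstructure S" "free_vars \<phi> \<subseteq> {..<n}"
    "\<forall>\<sigma>\<in>{id, star}. \<forall>e \<eta>. assigns n e \<eta>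
           \<longrightarrow> (holds \<eta> (map_fm \<sigma> \<phi>) \<longleftrightarrow> P \<sigma> e)"
    using assms unfolding definable_def by blast
  then show ?thesis
    unfolding definable_def by (intro exI[of _ "Neg \<phi>"]) auto
qed

lemma definable_conj:
  assumes "definable n P" "definable n Q"
  shows "definable n (\<lambda>\<sigma> e. P \<sigma> e \<and> Q \<sigma> e)"
proof -
  obtain \<phi> \<psi> where "set_fm \<phi> \<subseteq> superstructure S" "free_vars \<phi> \<subseteq> {..<n}"
    "set_fm \<psi> \<subseteq> superstructure S" "free_vars \<psi> \<subseteq> {..<n}"
    "\<forall>\<sigma>\<in>{id, star}. \<forall>e \<eta>. assigns n e \<eta>
           \<longrightarrow> (holds \<eta> (map_fm \<sigma> \<phi>) \<longleftrightarrow> P \<sigma> e)"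
    "\<forall>\<sigma>\<in>{id, star}. \<forall>e \<eta>. assigns n e \<eta>
           \<longrightarrow> (holds \<eta> (map_fm \<sigma> \<psi>) \<longleftrightarrow> Q \<sigma> e)"
    using assms unfolding definable_def by blast
  then show ?thesis
    unfolding definable_def by (intro exI[of _ "Conj \<phi> \<psi>"]) auto
qed

lemma definable_imp:
  assumes "definable n P" "definable n Q"
  shows "definable n (\<lambda>\<sigma> e. P \<sigma> e \<longrightarrow> Q \<sigma> e)"
proof -
  have "(\<lambda>\<sigma> e. P \<sigma> e \<longrightarrow> Q \<sigma> e) = (\<lambda>\<sigma> e. \<not> (P \<sigma> e \<and> \<not> Q \<sigma> e))" by blast
  then show ?thesis by (simp only:) (intro definable_not definable_conj assms)
qed

text \<open>
  The bound variable is numbered \<open>n\<close>, so that it differs from the variables \<open>0, \<dots>, n - 1\<close>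
  already in use and the bounding term keeps its value inside the quantifier.
\<close>

lemma definable_ball:
  assumes "definable_term n t" "definable (Suc n) (\<lambda>\<sigma> e. P \<sigma> (tl e) (hd e))"
  shows "definable n (\<lambda>\<sigma> e. \<forall>x\<in>elts (t \<sigma> e). P \<sigma> e x)"
proof -
  obtain \<tau> where \<tau>: "set_trm \<tau> \<subseteq> superstructure S" "trm_vars \<tau> \<subseteq> {..<n}"
    and t: "\<And>\<sigma> e \<eta>. \<sigma> \<in> {id, star} \<Longrightarrow> assigns n e \<eta>
           \<Longrightarrow> trm_val \<eta> (map_trm \<sigma> \<tau>) = t \<sigma> e"
    using assms(1) unfolding definable_term_def by blast
  obtain \<phi> where \<phi>: "set_fm \<phi> \<subseteq> superstructure S" "free_vars \<phi> \<subseteq> {..<Suc n}"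
    and P: "\<And>\<sigma> e \<eta>. \<sigma> \<in> {id, star} \<Longrightarrow> assigns (Suc n) e \<eta>
           \<Longrightarrow> (holds \<eta> (map_fm \<sigma> \<phi>) \<longleftrightarrow> P \<sigma> (tl e) (hd e))"
    using assms(2) unfolding definable_def by blast
  have "holds \<eta> (map_fm \<sigma> (Ball n \<tau> \<phi>)) \<longleftrightarrow> (\<forall>x\<in>elts (t \<sigma> e). P \<sigma> e x)"
    if e: "\<sigma> \<in> {id, star}" "assigns n e \<eta>" for \<sigma> e \<eta>
  proof -
    have "holds (\<eta>(n := x)) (map_fm \<sigma> \<phi>) \<longleftrightarrow> P \<sigma> e x" for x
      using P[of \<sigma> "x # e" "\<eta>(n := x)"] e assigns_Cons by simp
    then show ?thesis using t[OF e] by simp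
  qed
  moreover have "free_vars (Ball n \<tau> \<phi>) \<subseteq> {..<n}"
    using \<tau>(2) \<phi>(2) by (auto simp: less_Suc_eq)
  ultimately show ?thesis
    unfolding definable_def using \<tau>(1) \<phi>(1) by (intro exI[of _ "Ball n \<tau> \<phi>"]) auto
qed

lemma definable_bex:
  assumes "definable_term n t" "definable (Suc n) (\<lambda>\<sigma> e. P \<sigma> (tl e) (hd e))"
  shows "definable n (\<lambda>\<sigma> e. \<exists>x\<in>elts (t \<sigma> e). P \<sigma> e x)"
proof -
  have "definable n (\<lambda>\<sigma> e. \<not> (\<forall>x\<in>elts (t \<sigma> e). \<not> P \<sigma> e x))"
    by (intro definable_not definable_ball assms)
  then show ?thesis by simp
qed

text \<open>
  This is available only for constants: their values lie in the superstructure over \<open>S\<close> or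
  \<open>star S\<close>, where being a set means not being in the base set.
\<close>

lemma definable_is_set:
  assumes c: "c \<in> superstructure S"
  shows "definable n (\<lambda>\<sigma> e. is_set (\<sigma> c))"
proof -
  have base: "base_set S" "base_set (star S)" and "star c \<in> superstructure (star S)"
    using enl c unfolding enlargement_def by auto
  then have "is_set (\<sigma> c) \<longleftrightarrow> \<sigma> c \<notin> elts (\<sigma> S)" if "\<sigma> \<in> {id, star}" for \<sigma>
    using that c is_set_iff_notin_base by fastforce
  moreover have "S \<in> superstructure S"
    using base(1) is_set_in_superstructure[of S S 0] unfolding base_set_def by simp
  ultimately show ?thesis
    unfolding definable_def using c
    by (intro exI[of _ "Neg (Mem (Const c) (Const S))"]) auto
qed

lemmas definable_intros =
  definable_term_const definable_term_hd definable_term_tl definable_term_kpair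
  definable_term_sapp definable_eq definable_mem definable_not definable_conj definable_imp
  definable_ball definable_bex

text \<open>
  In the last premise there are two bound variables, one for the witness and one for a competitor:
  the relation is applied to the competitor, and the witness is passed over by the second \<open>tl\<close>.
\<close>

lemma definable_bex1:
  assumes "definable_term n t" "definable (Suc n) (\<lambda>\<sigma> e. P \<sigma> (tl e) (hd e))"
    "definable (Suc (Suc n)) (\<lambda>\<sigma> e. P \<sigma> (tl (tl e)) (hd e))"
  shows "definable n (\<lambda>\<sigma> e. \<exists>!x. x \<in> elts (t \<sigma> e) \<and> P \<sigma> e x)"
proof -
  have "definable n (\<lambda>\<sigma> e. \<exists>x\<in>elts (t \<sigma> e). P \<sigma> e x \<and> (\<forall>y\<in>elts (t \<sigma> e). P \<sigma> e y \<longrightarrow> y = x))"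
    by (intro definable_intros assms)
  moreover have "(\<exists>x\<in>elts (t \<sigma> e). P \<sigma> e x \<and> (\<forall>y\<in>elts (t \<sigma> e). P \<sigma> e y \<longrightarrow> y = x))
      \<longleftrightarrow> (\<exists>!x. x \<in> elts (t \<sigma> e) \<and> P \<sigma> e x)" for \<sigma> e
    by blast
  ultimately show ?thesis by simp
qed

lemma definable_is_function:
  assumes "f \<in> superstructure S" "X \<in> superstructure S" "Y \<in> superstructure S"
  shows "definable n (\<lambda>\<sigma> e. is_function (\<sigma> f) (\<sigma> X) (\<sigma> Y))"
  unfolding is_function_def
  by (intro definable_intros definable_bex1 definable_is_set assms)

end


section \<open>Definability of categorical notions\<close>

text \<open>
  For \<open>\<sigma> = id\<close> the category \<open>enlarge_cat \<sigma> C\<close> is \<open>C\<close> itself, so \<open>enlarge_cat \<sigma> C\<close> below stands for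
  both the category and its enlargement.
\<close>

lemma enlarge_cat_id: "enlarge_cat id C = C"
  by (simp add: enlarge_cat_def)

lemma enlarge_cat_sel:
  "mor (enlarge_cat \<sigma> C) = \<sigma> (mor C)" "src (enlarge_cat \<sigma> C) = \<sigma> (src C)"
  "tgt (enlarge_cat \<sigma> C) = \<sigma> (tgt C)" "cmp (enlarge_cat \<sigma> C) = \<sigma> (cmp C)"
  "add (enlarge_cat \<sigma> C) = \<sigma> (add C)"
  by (simp_all add: enlarge_cat_def)

text \<open>This turns quantification over morphisms and objects into the bounded form of formulas.\<close>

lemma ball_Hom_Ob:
  "(\<forall>f\<in>Hom D a b. Q f) \<longleftrightarrow> (\<forall>f\<in>Mor D. Src D f = a \<and> Tgt D f = b \<longrightarrow> Q f)"
  "(\<forall>a\<in>Ob D. Q a) \<longleftrightarrow> (\<forall>a\<in>Mor D. Src D a = a \<longrightarrow> Q a)"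
  by (auto simp: Hom_def Ob_def)

locale enlarged_category = enlarged_superstructure S star
  for S :: "'u::set_universe" and star :: "'u \<Rightarrow> 'u" +
  fixes C :: "'u add_cat"
  assumes small: "small_in S C" and additive: "additive_category C"
begin

lemma in_superstructure:
  "mor C \<in> superstructure S" "src C \<in> superstructure S" "tgt C \<in> superstructure S"
  "cmp C \<in> superstructure S" "add C \<in> superstructure S"
proof -
  have "is_category C" and add: "is_ternary_relation (add C) (mor C)"
    using additive unfolding additive_category_def by simp_all
  then have C: "is_function (src C) (mor C) (mor C)" "is_function (tgt C) (mor C) (mor C)"
    "is_ternary_relation (cmp C) (mor C)"
    unfolding is_category_def by simp_all
  have mor: "mor C \<in> superstructure S - elts S"
    using small unfolding small_in_def .
  then show "mor C \<in> superstructure S" by simp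
  show "src C \<in> superstructure S" "tgt C \<in> superstructure S"
    by (rule function_in_superstructure[OF C(1) mor mor]
        function_in_superstructure[OF C(2) mor mor])+
  show "cmp C \<in> superstructure S" "add C \<in> superstructure S"
    by (rule ternary_relation_in_superstructure[OF C(3) mor]
        ternary_relation_in_superstructure[OF add mor])+
qed

lemma definable_term_mor: "definable_term n (\<lambda>\<sigma> e. mor (enlarge_cat \<sigma> C))"
  unfolding enlarge_cat_sel by (intro definable_intros in_superstructure)

lemma definable_term_Src:
  assumes "definable_term n f"
  shows "definable_term n (\<lambda>\<sigma> e. Src (enlarge_cat \<sigma> C) (f \<sigma> e))"
  unfolding enlarge_cat_sel by (intro definable_intros in_superstructure assms)

lemma definable_term_Tgt:
  assumes "definable_term n f"
  shows "definable_term n (\<lambda>\<sigma> e. Tgt (enlarge_cat \<sigma> C) (f \<sigma> e))"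
  unfolding enlarge_cat_sel by (intro definable_intros in_superstructure assms)

lemma definable_Comp:
  assumes "definable_term n g" "definable_term n f" "definable_term n h"
  shows "definable n (\<lambda>\<sigma> e. Comp (enlarge_cat \<sigma> C) (g \<sigma> e) (f \<sigma> e) (h \<sigma> e))"
  unfolding Comp_def ktriple_def enlarge_cat_sel
  by (intro definable_intros in_superstructure assms)

lemma definable_Sum:
  assumes "definable_term n f" "definable_term n g" "definable_term n h"
  shows "definable n (\<lambda>\<sigma> e. Sum (enlarge_cat \<sigma> C) (f \<sigma> e) (g \<sigma> e) (h \<sigma> e))"
  unfolding Sum_def ktriple_def enlarge_cat_sel
  by (intro definable_intros in_superstructure assms)

lemmas cat_intros = definable_term_mor definable_term_Src definable_term_Tgt
  definable_Comp definable_Sum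

lemma definable_is_zero_object:
  assumes "definable_term n z"
  shows "definable n (\<lambda>\<sigma> e. is_zero_object (enlarge_cat \<sigma> C) (z \<sigma> e))"
  unfolding is_zero_object_def ball_Hom_Ob unfolding Ob_def Hom_def mem_Collect_eq
  by (intro cat_intros definable_intros definable_bex1 assms)

lemma definable_is_zero_mor:
  assumes "definable_term n f"
  shows "definable n (\<lambda>\<sigma> e. is_zero_mor (enlarge_cat \<sigma> C) (f \<sigma> e))"
  unfolding is_zero_mor_def ball_Hom_Ob
  by (intro cat_intros definable_intros assms)

lemma definable_comp_zero:
  assumes "definable_term n g" "definable_term n f"
  shows "definable n (\<lambda>\<sigma> e. comp_zero (enlarge_cat \<sigma> C) (g \<sigma> e) (f \<sigma> e))"
  unfolding comp_zero_def
  by (intro definable_is_zero_mor cat_intros definable_intros assms)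

lemma definable_is_kernel:
  assumes "definable_term n k" "definable_term n f"
  shows "definable n (\<lambda>\<sigma> e. is_kernel (enlarge_cat \<sigma> C) (k \<sigma> e) (f \<sigma> e))"
  unfolding is_kernel_def
  by (intro definable_comp_zero cat_intros definable_intros definable_bex1 assms)

lemma definable_is_cokernel:
  assumes "definable_term n q" "definable_term n f"
  shows "definable n (\<lambda>\<sigma> e. is_cokernel (enlarge_cat \<sigma> C) (q \<sigma> e) (f \<sigma> e))"
  unfolding is_cokernel_def
  by (intro definable_comp_zero cat_intros definable_intros definable_bex1 assms)

lemma definable_exact_pair:
  assumes "definable_term n f" "definable_term n g"
  shows "definable n (\<lambda>\<sigma> e. exact_pair (enlarge_cat \<sigma> C) (f \<sigma> e) (g \<sigma> e))"
  unfolding exact_pair_def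
  by (intro definable_is_kernel definable_is_cokernel cat_intros definable_intros assms)

lemma definable_exact_zero_left:
  assumes "definable_term n f"
  shows "definable n (\<lambda>\<sigma> e. exact_zero_left (enlarge_cat \<sigma> C) (f \<sigma> e))"
  unfolding exact_zero_left_def
  by (intro definable_is_zero_object definable_exact_pair cat_intros definable_intros assms)

lemma definable_exact_zero_right:
  assumes "definable_term n g"
  shows "definable n (\<lambda>\<sigma> e. exact_zero_right (enlarge_cat \<sigma> C) (g \<sigma> e))"
  unfolding exact_zero_right_def
  by (intro definable_is_zero_object definable_exact_pair cat_intros definable_intros assms)

lemma definable_short_exact:
  assumes "definable_term n f" "definable_term n g"
  shows "definable n (\<lambda>\<sigma> e. short_exact (enlarge_cat \<sigma> C) (f \<sigma> e) (g \<sigma> e))"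
  unfolding short_exact_def
  by (intro definable_exact_zero_left definable_exact_zero_right definable_exact_pair
      definable_conj assms)

lemmas exactness_intros = definable_exact_pair definable_exact_zero_left
  definable_exact_zero_right definable_short_exact

end


section \<open>Transfer of properties of functors\<close>

locale enlarged_functor =
  enlarged_superstructure S star + A: enlarged_category S star A + B: enlarged_category S star B
  for S :: "'u::set_universe" and star :: "'u \<Rightarrow> 'u" and A B :: "'u add_cat" +
  fixes F :: 'u
  assumes functor_F: "is_functor A B F"
begin

lemma functor_in_superstructure: "F \<in> superstructure S"
  using functor_F A.small B.small function_in_superstructure
  unfolding is_functor_def small_in_def by blast

lemma definable_is_functor:
  "definable n (\<lambda>\<sigma> e. is_functor (enlarge_cat \<sigma> A) (enlarge_cat \<sigma> B) (\<sigma> F))"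
proof -
  have "definable n (\<lambda>\<sigma> e. is_function (\<sigma> F) (mor (enlarge_cat \<sigma> A)) (mor (enlarge_cat \<sigma> B)))"
    unfolding enlarge_cat_sel
    by (intro definable_is_function functor_in_superstructure A.in_superstructure
        B.in_superstructure)
  then show ?thesis
    unfolding is_functor_def
    by (intro A.cat_intros B.cat_intros definable_intros functor_in_superstructure)
qed

lemma definable_additive_functor:
  "definable n (\<lambda>\<sigma> e. additive_functor (enlarge_cat \<sigma> A) (enlarge_cat \<sigma> B) (\<sigma> F))"
  unfolding additive_functor_def
  by (intro definable_is_functor A.cat_intros B.cat_intros definable_intros
      functor_in_superstructure)

lemma definable_left_exact:
  "definable n (\<lambda>\<sigma> e. left_exact (enlarge_cat \<sigma> A) (enlarge_cat \<sigma> B) (\<sigma> F))"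
  unfolding left_exact_def
  by (intro definable_additive_functor A.exactness_intros B.exactness_intros
      A.cat_intros definable_intros functor_in_superstructure)

lemma definable_right_exact:
  "definable n (\<lambda>\<sigma> e. right_exact (enlarge_cat \<sigma> A) (enlarge_cat \<sigma> B) (\<sigma> F))"
  unfolding right_exact_def
  by (intro definable_additive_functor A.exactness_intros B.exactness_intros
      A.cat_intros definable_intros functor_in_superstructure)

lemma definable_exact_functor:
  "definable n (\<lambda>\<sigma> e. exact_functor (enlarge_cat \<sigma> A) (enlarge_cat \<sigma> B) (\<sigma> F))"
  unfolding exact_functor_def
  by (intro definable_additive_functor A.exactness_intros B.exactness_intros
      A.cat_intros definable_intros functor_in_superstructure)

lemma transfer_functor_properties:
  "additive_functor A B F
     \<longleftrightarrow> additive_functor (enlarge_cat star A) (enlarge_cat star B) (star F)"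
  "left_exact A B F \<longleftrightarrow> left_exact (enlarge_cat star A) (enlarge_cat star B) (star F)"
  "right_exact A B F \<longleftrightarrow> right_exact (enlarge_cat star A) (enlarge_cat star B) (star F)"
  "exact_functor A B F \<longleftrightarrow> exact_functor (enlarge_cat star A) (enlarge_cat star B) (star F)"
proof -
  note * = transfer_definable[where P = "\<lambda>\<sigma>. Q (enlarge_cat \<sigma> A) (enlarge_cat \<sigma> B) (\<sigma> F)" for Q,
      unfolded enlarge_cat_id id_apply]
  show "additive_functor A B F
      \<longleftrightarrow> additive_functor (enlarge_cat star A) (enlarge_cat star B) (star F)"
    by (rule *) (rule definable_additive_functor)
  show "left_exact A B F
      \<longleftrightarrow> left_exact (enlarge_cat star A) (enlarge_cat star B) (star F)"
    by (rule *) (rule definable_left_exact)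
  show "right_exact A B F
      \<longleftrightarrow> right_exact (enlarge_cat star A) (enlarge_cat star B) (star F)"
    by (rule *) (rule definable_right_exact)
  show "exact_functor A B F
      \<longleftrightarrow> exact_functor (enlarge_cat star A) (enlarge_cat star B) (star F)"
    by (rule *) (rule definable_exact_functor)
qed

end

theorem proposition4p5:
  fixes S F :: "'u::set_universe" and star :: "'u \<Rightarrow> 'u" and A B :: "'u add_cat"
  assumes "enlargement S (star S) star"
    and "small_in S A" and "additive_category A"
    and "small_in S B" and "additive_category B"
    and "is_functor A B F"
  shows
    "(additive_functor A B F \<longrightarrow>
        additive_functor (enlarge_cat star A) (enlarge_cat star B) (star F))
   \<and> (abelian_category A \<and> abelian_category B \<longrightarrow>
        (left_exact A B F \<longrightarrow>
           left_exact (enlarge_cat star A) (enlarge_cat star B) (star F))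
      \<and> (right_exact A B F \<longrightarrow>
           right_exact (enlarge_cat star A) (enlarge_cat star B) (star F))
      \<and> (exact_functor A B F \<longrightarrow>
           exact_functor (enlarge_cat star A) (enlarge_cat star B) (star F)))"
proof -
  interpret enlarged_functor S star A B F
    using assms by unfold_locales
  show ?thesis
    using transfer_functor_properties by blast
qed

end
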